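(* Let $(X,d)$ be a metric space and let $f_n: X\to X$ be continuous for each $n\geq 0$. If the system $x_{n+1}=f_n(x_n)$, $n\ge0$, has an uncountable Xiong-chaotic set with respect to an increasing sequence $P\subset\mathbf{N}$, then it is distributionally chaotic in a subsequence of $P$.
   Context: $\mathbf{N}$ denotes the set of nonnegative integers. For maps $f_n:X\to X$ ($n\ge0$), $f_0^0$ is the identity map on $X$ and $f_0^n:=f_{n-1}\circ\cdots\circ f_0$ for $n\ge1$. "Increasing sequence" means a strictly increasing infinite sequence. A subset $S\subset X$ is a Xiong-chaotic set with respect to a sequence $P=\{p_n\}_{n=1}^\infty\subset\mathbf{N}$ if for any continuous map $F:S\to X$ there is a subsequence $\{p_{n_k}\}_{k=1}^\infty$ of $P$ such that $\lim_{k\to\infty}f_0^{p_{n_k}}(x)=F(x)$ for all $x\in S$. For an increasing sequence $T=\{t_n\}_{n=1}^\infty\subset\mathbf{N}$, $x,y\in X$ and $\epsilon>0$, set $$F^*_{x,y}(\epsilon,T)=\limsup_{n\to\infty}\frac1n\sum_{i=1}^n\chi_{[0,\epsilon)}\big(d(f_0^{t_i}(x),f_0^{t_i}(y))\big),\qquad F_{x,y}(\epsilon,T)=\liminf_{n\to\infty}\frac1n\sum_{i=1}^n\chi_{[0,\epsilon)}\big(d(f_0^{t_i}(x),f_0^{t_i}(y))\big),$$ where $\chi_{[0,\epsilon)}$ is the characteristic function of $[0,\epsilon)$. A set $D\subset X$ with at least two points is a distributionally scrambled set in the sequence $T$ if for all $x,y\in D$ with $x\ne y$: $F^*_{x,y}(\epsilon,T)=1$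 for every $\epsilon>0$, and $F_{x,y}(\delta_{x,y},T)=0$ for some $\delta_{x,y}>0$. The system is distributionally chaotic in the sequence $T$ if it has an uncountable distributionally scrambled set in $T$. *)

theory Defs
  imports "HOL-Analysis.Analysis"
begin

text \<open>
  Sequences are functions on \<^typ>\<open>nat\<close> indexed from 0: for \<open>T :: nat \<Rightarrow> nat\<close>,
  the value \<open>T i\<close> is the term $t_{i+1}$. A subsequence of \<open>P\<close> is \<open>P \<circ> r\<close> with \<open>r\<close>
  strictly increasing.
\<close>

text \<open>\<open>f_iter f n\<close> is $f_0^n = f_{n-1} \circ \cdots \circ f_0$.\<close>

primrec f_iter :: "(nat \<Rightarrow> 'a \<Rightarrow> 'a) \<Rightarrow> nat \<Rightarrow> 'a \<Rightarrow> 'a" where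
  "f_iter f 0 = id"
| "f_iter f (Suc n) = f n \<circ> f_iter f n"

text \<open>A map $F : S \to X$ is a total function of which only the values on \<open>S\<close> matter.\<close>

definition xiong_chaotic_set ::
  "(nat \<Rightarrow> 'a::metric_space \<Rightarrow> 'a) \<Rightarrow> (nat \<Rightarrow> nat) \<Rightarrow> 'a set \<Rightarrow> bool" where
  "xiong_chaotic_set f P S \<longleftrightarrow>
    (\<forall>F :: 'a \<Rightarrow> 'a. continuous_on S F \<longrightarrow>
      (\<exists>r :: nat \<Rightarrow> nat. strict_mono r \<and>
        (\<forall>x\<in>S. (\<lambda>k. f_iter f (P (r k)) x) \<longlonglongrightarrow> F x)))"

definition close_freq ::
  "(nat \<Rightarrow> 'a::metric_space \<Rightarrow> 'a) \<Rightarrow> (nat \<Rightarrow> nat) \<Rightarrow> 'a \<Rightarrow> 'a \<Rightarrow> real \<Rightarrow> nat \<Rightarrow> real" where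
  "close_freq f T x y \<epsilon> n =
    (1 / real n) * (\<Sum>i<n. indicator {0..<\<epsilon>} (dist (f_iter f (T i) x) (f_iter f (T i) y)))"

text \<open>
  The limits are taken in \<^typ>\<open>ereal\<close>, a complete lattice; the frequencies lie in $[0,1]$,
  so these are the usual real upper and lower limits.
\<close>

definition upper_distrib ::
  "(nat \<Rightarrow> 'a::metric_space \<Rightarrow> 'a) \<Rightarrow> (nat \<Rightarrow> nat) \<Rightarrow> 'a \<Rightarrow> 'a \<Rightarrow> real \<Rightarrow> ereal" where
  "upper_distrib f T x y \<epsilon> = limsup (\<lambda>n. ereal (close_freq f T x y \<epsilon> n))"

definition lower_distrib ::
  "(nat \<Rightarrow> 'a::metric_space \<Rightarrow> 'a) \<Rightarrow> (nat \<Rightarrow> nat) \<Rightarrow> 'a \<Rightarrow> 'a \<Rightarrow> real \<Rightarrow> ereal" where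
  "lower_distrib f T x y \<epsilon> = liminf (\<lambda>n. ereal (close_freq f T x y \<epsilon> n))"

definition distrib_scrambled_set ::
  "(nat \<Rightarrow> 'a::metric_space \<Rightarrow> 'a) \<Rightarrow> (nat \<Rightarrow> nat) \<Rightarrow> 'a set \<Rightarrow> bool" where
  "distrib_scrambled_set f T D \<longleftrightarrow>
    (\<exists>x\<in>D. \<exists>y\<in>D. x \<noteq> y) \<and>
    (\<forall>x\<in>D. \<forall>y\<in>D. x \<noteq> y \<longrightarrow>
      (\<forall>\<epsilon>>0. upper_distrib f T x y \<epsilon> = 1) \<and>
      (\<exists>\<delta>>0. lower_distrib f T x y \<delta> = 0))"

definition distrib_chaotic_in ::
  "(nat \<Rightarrow> 'a::metric_space \<Rightarrow> 'a) \<Rightarrow> (nat \<Rightarrow> nat) \<Rightarrow> bool" where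
  "distrib_chaotic_in f T \<longleftrightarrow> (\<exists>D. uncountable D \<and> distrib_scrambled_set f T D)"

end

theory Submission
  imports Defs
begin

text \<open>
  If \<open>S\<close> is Xiong-chaotic, the two continuous maps ``constant \<open>c\<close>'' and ``identity'' on \<open>S\<close> yield
  two subsequences \<open>P \<circ> a\<close> and \<open>P \<circ> b\<close>: along the first one all orbits starting in \<open>S\<close> collapse
  to \<open>c\<close>, so that the distance of any two of them tends to \<open>0\<close>; along the second one each orbit
  returns to its starting point, so that the distance tends to the distance of the two starting
  points, which is positive if they differ. A subsequence of \<open>P\<close> that takes its terms alternately
  from \<open>P \<circ> a\<close> and \<open>P \<circ> b\<close>, in blocks so long that each one outweighs everything before it, has
  close frequencies near \<open>1\<close> at the ends of the collapsing blocks and near \<open>0\<close> at the ends of the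
  returning blocks. The whole of \<open>S\<close> is then distributionally scrambled in this subsequence.

  The \<open>k\<close>-th block is the interval from \<open>k!\<close> to \<open>(k + 1)!\<close>. At its end, the earlier indices
  contribute at most \<open>1/(k + 1)\<close> to an average of numbers in the unit interval
  (\<open>average_near_last_block_value\<close>), and this error tends to \<open>0\<close>.
\<close>

section \<open>Averages over factorial blocks\<close>

definition average :: "(nat \<Rightarrow> real) \<Rightarrow> nat \<Rightarrow> real" where
  "average u n = (1 / real n) * (\<Sum>i<n. u i)"

lemma average_bounds:
  assumes "\<And>i. 0 \<le> u i" "\<And>i. u i \<le> 1"
  shows "0 \<le> average u n" "average u n \<le> 1"
proof -
  show "0 \<le> average u n"
    unfolding average_def using assms(1) by (intro mult_nonneg_nonneg sum_nonneg) auto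
  have "(\<Sum>i<n. u i) \<le> real n"
    using sum_bounded_above[of "{..<n}" u 1] assms(2) by simp
  then show "average u n \<le> 1"
    unfolding average_def by (cases "n = 0") (auto simp: field_simps)
qed

text \<open>
  Only the indices before \<open>k!\<close> contribute to the deviation from \<open>c\<close>, and they are a fraction
  \<open>k! / (k + 1)! = 1 / (k + 1)\<close> of all indices; this ratio is what factorial block ends are
  chosen for.
\<close>
lemma average_near_last_block_value:
  assumes "\<And>i. \<bar>u i - c\<bar> \<le> 1"
    and last_block: "\<And>i. fact k \<le> i \<Longrightarrow> i < fact (Suc k) \<Longrightarrow> u i = c"
  shows "\<bar>average u (fact (Suc k)) - c\<bar> \<le> 1 / real (Suc k)"
proof -
  have pos: "0 < real (fact (Suc k))"
    using fact_gt_zero[of "Suc k", where ?'a = nat] by linarith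
  have "(\<Sum>i<fact (Suc k). u i - c) = (\<Sum>i<fact k. u i - c)"
    using last_block fact_mono[of k "Suc k", where ?'a = nat]
    by (intro sum.mono_neutral_right) auto
  also have "\<bar>\<dots>\<bar> \<le> (\<Sum>i<fact k. \<bar>u i - c\<bar>)"
    by (rule sum_abs)
  also have "\<dots> \<le> real (fact k)"
    using sum_bounded_above[of "{..<fact k}" "\<lambda>i. \<bar>u i - c\<bar>" 1] assms(1) by simp
  finally have sum: "\<bar>\<Sum>i<fact (Suc k). u i - c\<bar> \<le> real (fact k)" .
  have "average u (fact (Suc k)) - c = (\<Sum>i<fact (Suc k). u i - c) / real (fact (Suc k))"
    using pos by (simp add: average_def sum_subtractf diff_divide_distrib del: fact_Suc)
  then have "\<bar>average u (fact (Suc k)) - c\<bar> \<le> real (fact k) / real (fact (Suc k))"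
    using divide_right_mono[OF sum, of "real (fact (Suc k))"] pos
    by (simp add: abs_divide del: fact_Suc)
  also have "\<dots> = 1 / real (Suc k)"
    unfolding fact_Suc of_nat_mult of_nat_id by (simp del: of_nat_Suc)
  finally show ?thesis .
qed

text \<open>
  The blocks on which \<open>u\<close> equals \<open>c\<close> are numbered by a strictly increasing \<open>m\<close>. The average at the
  end of a block is governed by that block alone, so one sequence of averages can approach two
  different values along the ends of two families of blocks.
\<close>
lemma average_tendsto_along_block_ends:
  fixes m :: "nat \<Rightarrow> nat"
  assumes "\<And>i. \<bar>u i - c\<bar> \<le> 1" and "strict_mono m"
    and "\<forall>\<^sub>F i in sequentially. (\<exists>j. fact (m j) \<le> i \<and> i < fact (Suc (m j))) \<longrightarrow> u i = c"
  shows "((average u) \<circ> (\<lambda>j. fact (Suc (m j)))) \<longlonglongrightarrow> c"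
proof -
  obtain N where N: "\<And>i. N \<le> i \<Longrightarrow> (\<exists>j. fact (m j) \<le> i \<and> i < fact (Suc (m j))) \<Longrightarrow> u i = c"
    using assms(3) unfolding eventually_sequentially by blast
  have bound: "norm (average u (fact (Suc (m j))) - c) \<le> 1 / real (Suc (m j))" if "N \<le> j" for j
  proof -
    have "j \<le> fact (m j)"
      using seq_suble[OF assms(2), of j] fact_ge_self[of "m j"] by linarith
    then have "u i = c" if "fact (m j) \<le> i" "i < fact (Suc (m j))" for i
      using N[of i] that \<open>N \<le> j\<close> by (metis order_trans)
    then show ?thesis
      using average_near_last_block_value[OF assms(1)] by simp
  qed
  have "(\<lambda>j. 1 / real (Suc (m j))) \<longlonglongrightarrow> 0"
    using LIMSEQ_subseq_LIMSEQ[OF LIMSEQ_inverse_real_of_nat assms(2)]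
    by (simp add: o_def inverse_eq_divide)
  then have "(\<lambda>j. average u (fact (Suc (m j))) - c) \<longlonglongrightarrow> 0"
    by (rule Lim_null_comparison[rotated])
       (use bound in \<open>auto simp: eventually_sequentially simp del: fact_Suc of_nat_Suc\<close>)
  then show ?thesis
    by (simp add: LIM_zero_iff o_def del: fact_Suc)
qed

lemma strict_mono_block_end:
  fixes m :: "nat \<Rightarrow> nat"
  assumes "strict_mono m"
  shows "strict_mono (\<lambda>j. fact (Suc (m j)) :: nat)"
  using assms by (intro strict_monoI fact_less_mono_nat) (auto dest: strict_monoD)

lemma limsup_average_eq_1:
  fixes m :: "nat \<Rightarrow> nat"
  assumes "\<And>i. 0 \<le> u i" "\<And>i. u i \<le> 1" "strict_mono m"
    and "\<forall>\<^sub>F i in sequentially. (\<exists>j. fact (m j) \<le> i \<and> i < fact (Suc (m j))) \<longrightarrow> u i = 1"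
  shows "limsup (\<lambda>n. ereal (average u n)) = 1"
proof (rule antisym)
  show "limsup (\<lambda>n. ereal (average u n)) \<le> 1"
    using average_bounds(2)[of u] assms(1,2) by (intro Limsup_bounded) auto
  let ?e = "\<lambda>j. fact (Suc (m j)) :: nat"
  have "\<bar>u i - 1\<bar> \<le> 1" for i
    using assms(1,2)[of i] by simp
  then have "(average u \<circ> ?e) \<longlonglongrightarrow> 1"
    using average_tendsto_along_block_ends[OF _ assms(3,4)] by blast
  then have "((\<lambda>n. ereal (average u n)) \<circ> ?e) \<longlonglongrightarrow> 1"
    by (simp add: o_def one_ereal_def del: fact_Suc)
  then have "limsup ((\<lambda>n. ereal (average u n)) \<circ> ?e) = 1"
    by (intro lim_imp_Limsup) auto
  then show "1 \<le> limsup (\<lambda>n. ereal (average u n))"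
    using limsup_subseq_mono[OF strict_mono_block_end[OF assms(3)]] by metis
qed

lemma liminf_average_eq_0:
  fixes m :: "nat \<Rightarrow> nat"
  assumes "\<And>i. 0 \<le> u i" "\<And>i. u i \<le> 1" "strict_mono m"
    and "\<forall>\<^sub>F i in sequentially. (\<exists>j. fact (m j) \<le> i \<and> i < fact (Suc (m j))) \<longrightarrow> u i = 0"
  shows "liminf (\<lambda>n. ereal (average u n)) = 0"
proof (rule antisym)
  show "0 \<le> liminf (\<lambda>n. ereal (average u n))"
    using average_bounds(1)[of u] assms(1,2) by (intro Liminf_bounded) auto
  let ?e = "\<lambda>j. fact (Suc (m j)) :: nat"
  have "\<bar>u i - 0\<bar> \<le> 1" for i
    using assms(1,2)[of i] by simp
  then have "(average u \<circ> ?e) \<longlonglongrightarrow> 0"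
    using average_tendsto_along_block_ends[OF _ assms(3,4)] by blast
  then have "((\<lambda>n. ereal (average u n)) \<circ> ?e) \<longlonglongrightarrow> 0"
    by (simp add: o_def zero_ereal_def del: fact_Suc)
  then have "liminf ((\<lambda>n. ereal (average u n)) \<circ> ?e) = 0"
    by (intro lim_imp_Liminf) auto
  then show "liminf (\<lambda>n. ereal (average u n)) \<le> 0"
    using liminf_subseq_mono[OF strict_mono_block_end[OF assms(3)]] by metis
qed

section \<open>Interleaving two subsequences\<close>

text \<open>
  An infinite set of natural numbers has elements beyond any bound, so each term can be chosen
  larger than its predecessor, whatever set is prescribed next.
\<close>
lemma strict_mono_choice_from_infinite_sets:
  fixes A :: "nat \<Rightarrow> nat set"
  assumes "\<And>i. infinite (A i)"
  shows "\<exists>r. strict_mono r \<and> (\<forall>i. r i \<in> A i)"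
proof -
  have "\<exists>r. \<forall>i. r i \<in> A i \<and> r i < r (Suc i)"
  proof (rule dependent_nat_choice)
    show "\<exists>x. x \<in> A 0"
      using assms[of 0] infinite_imp_nonempty by blast
    show "\<exists>y. y \<in> A (Suc i) \<and> x < y" for x i
      using assms[of "Suc i"] unfolding infinite_nat_iff_unbounded by blast
  qed
  then show ?thesis
    unfolding strict_mono_Suc_iff by blast
qed

text \<open>
  Convergence along \<open>a\<close> is inherited by the terms that \<open>r\<close> takes from \<open>a\<close>, although \<open>r\<close> is not a
  subsequence of \<open>a\<close>: since \<open>r i \<ge> i\<close>, those terms lie far out in \<open>a\<close> when \<open>i\<close> is large.
\<close>
lemma eventually_transfer_to_interleaving:
  fixes a r :: "nat \<Rightarrow> nat"
  assumes "strict_mono a" "strict_mono r" "\<forall>\<^sub>F k in sequentially. Q (a k)"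
  shows "\<forall>\<^sub>F i in sequentially. r i \<in> range a \<longrightarrow> Q (r i)"
proof -
  obtain K where K: "\<And>k. K \<le> k \<Longrightarrow> Q (a k)"
    using assms(3) unfolding eventually_sequentially by blast
  have "Q (r i)" if "a K \<le> i" and "r i \<in> range a" for i
  proof -
    obtain k where k: "r i = a k"
      using \<open>r i \<in> range a\<close> by blast
    have "a K \<le> a k"
      using \<open>a K \<le> i\<close> seq_suble[OF assms(2), of i] k by linarith
    then show ?thesis
      using K[of k] k assms(1) by (simp add: strict_mono_less_eq)
  qed
  then show ?thesis
    unfolding eventually_sequentially by blast
qed

lemma factorial_blocks_disjoint:
  fixes i :: nat
  assumes "fact k \<le> i" "i < fact (Suc k)" "fact l \<le> i" "i < fact (Suc l)"
  shows "k = l"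
proof (rule ccontr)
  assume "k \<noteq> l"
  then consider "Suc k \<le> l" | "Suc l \<le> k"
    by linarith
  then show False
    using assms fact_mono[of "Suc k" l, where ?'a = nat] fact_mono[of "Suc l" k, where ?'a = nat]
    by cases linarith+
qed

lemma exists_block_interleaving:
  fixes a b :: "nat \<Rightarrow> nat"
  assumes "strict_mono a" "strict_mono b"
  shows "\<exists>r :: nat \<Rightarrow> nat. strict_mono r \<and>
    (\<forall>i. (\<exists>j. fact (2 * j) \<le> i \<and> i < fact (Suc (2 * j))) \<longrightarrow> r i \<in> range a) \<and>
    (\<forall>i. (\<exists>j. fact (2 * j + 1) \<le> i \<and> i < fact (Suc (2 * j + 1))) \<longrightarrow> r i \<in> range b)"
proof -
  define A where
    "A i = (if \<exists>j. fact (2 * j) \<le> i \<and> i < fact (Suc (2 * j)) then range a else range b)"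
    for i :: nat
  have "infinite (range a)" "infinite (range b)"
    using assms by (auto simp: range_inj_infinite strict_mono_imp_inj_on)
  then have "infinite (A i)" for i
    by (simp add: A_def)
  then obtain r where r: "strict_mono r" "\<And>i. r i \<in> A i"
    using strict_mono_choice_from_infinite_sets by blast
  have "r i \<in> range b" if "fact (2 * j + 1) \<le> i" "i < fact (Suc (2 * j + 1))" for i j
  proof -
    have "\<not> (fact (2 * l) \<le> i \<and> i < fact (Suc (2 * l)))" for l
      using factorial_blocks_disjoint[OF that, of "2 * l"] by presburger
    then show ?thesis
      using r(2)[of i] unfolding A_def by (auto simp del: fact_Suc split: if_splits)
  qed
  moreover have "r i \<in> range a" if "\<exists>j. fact (2 * j) \<le> i \<and> i < fact (Suc (2 * j))" for i
    using r(2)[of i] that unfolding A_def by (simp del: fact_Suc split: if_splits)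
  ultimately show ?thesis
    using r(1) by blast
qed

section \<open>From Xiong chaos to distributional chaos\<close>

lemma close_freq_eq_average:
  "close_freq f T x y \<epsilon> = average (\<lambda>i. indicator {0..<\<epsilon>} (dist (f_iter f (T i) x) (f_iter f (T i) y)))"
  by (simp add: fun_eq_iff close_freq_def average_def)

theorem theorem5p2:
  fixes f :: "nat \<Rightarrow> 'a::metric_space \<Rightarrow> 'a" and P :: "nat \<Rightarrow> nat"
  assumes "\<And>n. continuous_on UNIV (f n)"
    and "strict_mono P"
    and "\<exists>S. uncountable S \<and> xiong_chaotic_set f P S"
  shows "\<exists>r :: nat \<Rightarrow> nat. strict_mono r \<and> distrib_chaotic_in f (P \<circ> r)"
proof -
  obtain S where unc: "uncountable S" and xiong: "xiong_chaotic_set f P S"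
    using assms(3) by blast
  define g where "g n x = f_iter f (P n) x" for n x
  obtain c where "c \<in> S"
    using unc by (metis all_not_in_conv countable_empty)
  obtain a where a: "strict_mono a" "\<And>x. x \<in> S \<Longrightarrow> (\<lambda>k. g (a k) x) \<longlonglongrightarrow> c"
    using xiong[unfolded xiong_chaotic_set_def, rule_format, of "\<lambda>_. c"]
    unfolding g_def by auto
  obtain b where b: "strict_mono b" "\<And>x. x \<in> S \<Longrightarrow> (\<lambda>k. g (b k) x) \<longlonglongrightarrow> x"
    using xiong[unfolded xiong_chaotic_set_def, rule_format, of "\<lambda>x. x"]
    unfolding g_def by auto
  obtain r :: "nat \<Rightarrow> nat" where r: "strict_mono r"
    and r_a: "\<And>i. \<exists>j. fact (2 * j) \<le> i \<and> i < fact (Suc (2 * j)) \<Longrightarrow> r i \<in> range a"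
    and r_b: "\<And>i. \<exists>j. fact (2 * j + 1) \<le> i \<and> i < fact (Suc (2 * j + 1)) \<Longrightarrow> r i \<in> range b"
    using exists_block_interleaving[OF a(1) b(1)] by blast

  have upper: "upper_distrib f (P \<circ> r) x y \<epsilon> = 1" if "x \<in> S" "y \<in> S" "0 < \<epsilon>" for x y \<epsilon>
  proof -
    have "(\<lambda>k. dist (g (a k) x) (g (a k) y)) \<longlonglongrightarrow> dist c c"
      using that by (intro tendsto_dist a)
    then have "\<forall>\<^sub>F k in sequentially. dist (g (a k) x) (g (a k) y) < \<epsilon>"
      using \<open>0 < \<epsilon>\<close> by (intro order_tendstoD) auto
    then have "\<forall>\<^sub>F i in sequentially. r i \<in> range a \<longrightarrow> dist (g (r i) x) (g (r i) y) < \<epsilon>"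
      by (rule eventually_transfer_to_interleaving[OF a(1) r])
    then have "\<forall>\<^sub>F i in sequentially. (\<exists>j. fact (2 * j) \<le> i \<and> i < fact (Suc (2 * j))) \<longrightarrow>
        indicator {0..<\<epsilon>} (dist (g (r i) x) (g (r i) y)) = (1 :: real)"
      by (rule eventually_mono) (use r_a in \<open>auto simp del: fact_Suc\<close>)
    then show ?thesis
      unfolding upper_distrib_def close_freq_eq_average g_def o_def
      by (intro limsup_average_eq_1[where m = "\<lambda>j. 2 * j"])
         (auto simp: strict_mono_def indicator_def simp del: fact_Suc)
  qed

  \<comment> \<open>Any threshold below \<open>dist x y\<close>, the limit distance along \<open>b\<close>, separates the pair; half of it
    is positive and below.\<close>
  have lower: "lower_distrib f (P \<circ> r) x y (dist x y / 2) = 0"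
    if "x \<in> S" "y \<in> S" "x \<noteq> y" for x y
  proof -
    have "(\<lambda>k. dist (g (b k) x) (g (b k) y)) \<longlonglongrightarrow> dist x y"
      using that by (intro tendsto_dist b)
    then have "\<forall>\<^sub>F k in sequentially. dist x y / 2 < dist (g (b k) x) (g (b k) y)"
      using \<open>x \<noteq> y\<close> by (intro order_tendstoD) auto
    then have "\<forall>\<^sub>F i in sequentially. r i \<in> range b \<longrightarrow> dist x y / 2 < dist (g (r i) x) (g (r i) y)"
      by (rule eventually_transfer_to_interleaving[OF b(1) r])
    then have "\<forall>\<^sub>F i in sequentially. (\<exists>j. fact (2 * j + 1) \<le> i \<and> i < fact (Suc (2 * j + 1))) \<longrightarrow>
        indicator {0..<dist x y / 2} (dist (g (r i) x) (g (r i) y)) = (0 :: real)"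
      by (rule eventually_mono) (use r_b in \<open>auto simp del: fact_Suc simp: indicator_def\<close>)
    then show ?thesis
      unfolding lower_distrib_def close_freq_eq_average g_def o_def
      by (intro liminf_average_eq_0[where m = "\<lambda>j. 2 * j + 1"])
         (auto simp: strict_mono_def indicator_def simp del: fact_Suc)
  qed

  have two_points: "\<exists>x\<in>S. \<exists>y\<in>S. x \<noteq> y"
  proof (rule ccontr)
    assume "\<not> (\<exists>x\<in>S. \<exists>y\<in>S. x \<noteq> y)"
    then have "S = {} \<or> (\<exists>x. S = {x})"
      by blast
    then show False
      using unc by auto
  qed
  have "\<exists>\<delta>>0. lower_distrib f (P \<circ> r) x y \<delta> = 0" if "x \<in> S" "y \<in> S" "x \<noteq> y" for x y
    using lower[OF that] \<open>x \<noteq> y\<close> by (intro exI[of _ "dist x y / 2"]) simp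
  then have "distrib_scrambled_set f (P \<circ> r) S"
    unfolding distrib_scrambled_set_def using two_points upper by blast
  then show ?thesis
    using r unc unfolding distrib_chaotic_in_def by blast
qed

end
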